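(* Let $p>1$. There exists a power-$p$-porous subset $A$ of $\mathbb{R}^2$ of Lebesgue measure zero such that the set of all curves $\gamma\in\Gamma_1(\mathbb{R}^2)$ for which $\gamma^{-1}(A)$ has Lebesgue measure zero is not a residual subset of $\Gamma_1(\mathbb{R}^2)$.
   Context: For a metric space $(M,d)$ and $p>1$, a set $P\subseteq M$ is power-$p$-porous at $x\in P$ if for every $\epsilon>0$ there exist $h\in M$ and $r>0$ with $d(h,x)<\epsilon$, $B(h,r)\cap P=\emptyset$ and $r>d(h,x)^p$, where $B(h,r)$ is the open ball. $P$ is power-$p$-porous if it is power-$p$-porous at every $x\in P$. Here $\mathbb{R}^2$ carries the Euclidean metric. $\Gamma_1(\mathbb{R}^2)=C^1([0,1],\mathbb{R}^2)$ is the Banach space of continuously differentiable maps with norm $\|\gamma\|+\|\gamma'\|$ (supremum norms). A subset of $\Gamma_1(\mathbb{R}^2)$ is residual if its complement is of first category (meagre). For arbitrary subsets of $[0,1]$, measure means Lebesgue outer measure. *)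

theory Defs
  imports "HOL-Analysis.Analysis"
begin

definition power_porous_at :: "real \<Rightarrow> 'a::metric_space set \<Rightarrow> 'a \<Rightarrow> bool" where
  "power_porous_at p P x \<longleftrightarrow>
     (\<forall>\<epsilon>>0. \<exists>h r. r > 0 \<and> dist h x < \<epsilon> \<and> ball h r \<inter> P = {} \<and> r > dist h x powr p)"

definition power_porous :: "real \<Rightarrow> 'a::metric_space set \<Rightarrow> bool" where
  "power_porous p P \<longleftrightarrow> (\<forall>x\<in>P. power_porous_at p P x)"

definition nowhere_dense :: "'a::topological_space set \<Rightarrow> bool" where
  "nowhere_dense N \<longleftrightarrow> interior (closure N) = {}"

definition meagre :: "'a::topological_space set \<Rightarrow> bool" where
  "meagre S \<longleftrightarrow> (\<exists>N :: nat \<Rightarrow> 'a set. (\<forall>n. nowhere_dense (N n)) \<and> S = (\<Union>n. N n))"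

definition residual :: "'a::topological_space set \<Rightarrow> bool" where
  "residual S \<longleftrightarrow> meagre (- S)"


text \<open>
  The type \<open>'a c1_curve\<close> is the space of continuously differentiable maps from \<open>[0,1]\<close> to \<open>'a\<close>.
  Derivatives are taken within \<open>[0,1]\<close>, so they are one-sided at the endpoints. A map on \<open>[0,1]\<close> is
  represented by its extension by zero to all of \<open>real\<close>; the values outside \<open>[0,1]\<close> only serve to
  make the representation unique.
\<close>

typedef (overloaded) 'a c1_curve =
  "{\<gamma> :: real \<Rightarrow> 'a::real_normed_vector.
      (\<forall>t\<in>{0..1}. \<gamma> differentiable (at t within {0..1})) \<and>
      continuous_on {0..1} (\<lambda>t. vector_derivative \<gamma> (at t within {0..1})) \<and>
      (\<forall>t. t \<notin> {0..1} \<longrightarrow> \<gamma> t = 0)}"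
  morphisms curve Abs_c1_curve
proof -
  have "vector_derivative (\<lambda>_. 0 :: 'a) (at t within {0..1}) = 0" if "t \<in> {0..1}" for t :: real
    using that vector_derivative_within_cbox[of 0 1 t "\<lambda>_. 0 :: 'a" 0]
    by (simp add: has_vector_derivative_const)
  then have "continuous_on {0..1} (\<lambda>t::real. vector_derivative (\<lambda>_. 0 :: 'a) (at t within {0..1}))"
    by (simp cong: continuous_on_cong_simp)
  then show ?thesis by (intro exI[of _ "\<lambda>_. 0"]) simp
qed

definition curve_deriv :: "'a::real_normed_vector c1_curve \<Rightarrow> real \<Rightarrow> 'a" where
  "curve_deriv \<gamma> t = vector_derivative (curve \<gamma>) (at t within {0..1})"

lemma vector_derivative_within_01:
  fixes f :: "real \<Rightarrow> 'a::real_normed_vector"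
  assumes "(f has_vector_derivative D) (at t within {0..1})" "t \<in> {0..1}"
  shows "vector_derivative f (at t within {0..1}) = D"
  using assms vector_derivative_within_cbox[of 0 1 t f D] by simp

lemma curve_has_deriv:
  "t \<in> {0..1} \<Longrightarrow> (curve \<gamma> has_vector_derivative curve_deriv \<gamma> t) (at t within {0..1})"
  using curve[of \<gamma>] by (simp add: curve_deriv_def vector_derivative_works)

lemma curve_outside: "t \<notin> {0..1} \<Longrightarrow> curve \<gamma> t = 0"
  using curve[of \<gamma>] by blast

lemma continuous_on_curve_deriv: "continuous_on {0..1} (curve_deriv \<gamma>)"
  using curve[of \<gamma>] by (simp add: curve_deriv_def[abs_def])

lemma continuous_on_curve: "continuous_on {0..1} (curve \<gamma>)"
  by (meson curve_has_deriv continuous_on_eq_continuous_within has_vector_derivative_continuous)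

lemma c1_curve_eqI: "(\<And>t. t \<in> {0..1} \<Longrightarrow> curve \<gamma> t = curve \<delta> t) \<Longrightarrow> \<gamma> = \<delta>"
  by (metis curve_inject curve_outside ext)

text \<open>Every map with a continuous derivative on \<open>[0,1]\<close> gives an element of the space.\<close>

lemma c1_curve_exists:
  fixes f :: "real \<Rightarrow> 'a::real_normed_vector"
  assumes D: "\<And>t. t \<in> {0..1} \<Longrightarrow> (f has_vector_derivative D t) (at t within {0..1})"
    and cont: "continuous_on {0..1} D"
  obtains \<gamma> where "\<And>t. t \<in> {0..1} \<Longrightarrow> curve \<gamma> t = f t"
    and "\<And>t. t \<in> {0..1} \<Longrightarrow> curve_deriv \<gamma> t = D t"
proof -
  define g where "g t = (if t \<in> {0..1} then f t else 0)" for t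
  have g: "(g has_vector_derivative D t) (at t within {0..1})" if "t \<in> {0..1}" for t
    by (rule has_vector_derivative_transform[OF that _ D[OF that]]) (auto simp: g_def)
  then have gD: "vector_derivative g (at t within {0..1}) = D t" if "t \<in> {0..1}" for t
    using that vector_derivative_within_01 by blast
  have c: "continuous_on {0..1} (\<lambda>t. vector_derivative g (at t within {0..1}))"
    using cont by (rule continuous_on_eq) (simp add: gD)
  have "g \<in> {\<gamma>. (\<forall>t\<in>{0..1}. \<gamma> differentiable (at t within {0..1})) \<and>
      continuous_on {0..1} (\<lambda>t. vector_derivative \<gamma> (at t within {0..1})) \<and>
      (\<forall>t. t \<notin> {0..1} \<longrightarrow> \<gamma> t = 0)}"
    using g c differentiableI_vector by (force simp: g_def)
  then have "curve (Abs_c1_curve g) = g" by (rule Abs_c1_curve_inverse)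
  then show ?thesis
    by (intro that[of "Abs_c1_curve g"]) (use gD in \<open>auto simp: g_def curve_deriv_def\<close>)
qed

instantiation c1_curve :: (real_normed_vector) real_vector
begin

definition "0 = Abs_c1_curve (\<lambda>_. 0)"
definition "\<gamma> + \<delta> = Abs_c1_curve (\<lambda>t. curve \<gamma> t + curve \<delta> t)"
definition "\<gamma> - \<delta> = Abs_c1_curve (\<lambda>t. curve \<gamma> t - curve \<delta> t)"
definition "- \<gamma> = Abs_c1_curve (\<lambda>t. - curve \<gamma> t)"
definition "c *\<^sub>R \<gamma> = Abs_c1_curve (\<lambda>t. c *\<^sub>R curve \<gamma> t)"

lemma curve_Abs:
  fixes f :: "real \<Rightarrow> 'b::real_normed_vector"
  assumes "\<And>t. t \<in> {0..1} \<Longrightarrow> (f has_vector_derivative D t) (at t within {0..1})"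
    and "continuous_on {0..1} D" and "\<And>t. t \<notin> {0..1} \<Longrightarrow> f t = 0"
  shows "curve (Abs_c1_curve f) = f"
proof -
  obtain \<gamma> where \<gamma>: "\<And>t. t \<in> {0..1} \<Longrightarrow> curve \<gamma> t = f t"
    by (rule c1_curve_exists[OF assms(1,2)]) (assumption | rule that)+
  have "f t = curve \<gamma> t" for t
    by (cases "t \<in> {0..1}") (simp_all only: \<gamma> assms(3) curve_outside not_False_eq_True)
  then have "f = curve \<gamma>" by (rule ext)
  then show ?thesis by (simp add: curve_inverse)
qed

lemma curve_zero [simp]: "curve 0 t = 0"
  unfolding zero_c1_curve_def by (subst curve_Abs[OF has_vector_derivative_const continuous_on_const]) simp_all

lemma curve_add [simp]: "curve (\<gamma> + \<delta>) t = curve \<gamma> t + curve \<delta> t"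
  unfolding plus_c1_curve_def
  by (subst curve_Abs[OF has_vector_derivative_add[OF curve_has_deriv curve_has_deriv]
        continuous_on_add[OF continuous_on_curve_deriv continuous_on_curve_deriv]]) (simp_all add: curve_outside)

lemma curve_diff [simp]: "curve (\<gamma> - \<delta>) t = curve \<gamma> t - curve \<delta> t"
  unfolding minus_c1_curve_def
  by (subst curve_Abs[OF has_vector_derivative_diff[OF curve_has_deriv curve_has_deriv]
        continuous_on_diff[OF continuous_on_curve_deriv continuous_on_curve_deriv]]) (simp_all add: curve_outside)

lemma curve_uminus [simp]: "curve (- \<gamma>) t = - curve \<gamma> t"
  unfolding uminus_c1_curve_def
  by (subst curve_Abs[OF has_vector_derivative_minus[OF curve_has_deriv]
        continuous_on_minus[OF continuous_on_curve_deriv]]) (simp_all add: curve_outside)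

lemma curve_scaleR [simp]: "curve (c *\<^sub>R \<gamma>) t = c *\<^sub>R curve \<gamma> t"
  unfolding scaleR_c1_curve_def
  by (subst curve_Abs[OF bounded_linear.has_vector_derivative[OF bounded_linear_scaleR_right curve_has_deriv]
        continuous_on_scaleR[OF continuous_on_const continuous_on_curve_deriv]]) (simp_all add: curve_outside)

instance
  by standard (auto intro!: c1_curve_eqI simp: algebra_simps)

end

lemma curve_derivI:
  "(curve \<gamma> has_vector_derivative D) (at t within {0..1}) \<Longrightarrow> t \<in> {0..1} \<Longrightarrow> curve_deriv \<gamma> t = D"
  unfolding curve_deriv_def by (rule vector_derivative_within_01)

lemma curve_deriv_simps [simp]:
  assumes "t \<in> {0..1}"
  shows "curve_deriv 0 t = 0"
    and "curve_deriv (\<gamma> + \<delta>) t = curve_deriv \<gamma> t + curve_deriv \<delta> t"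
    and "curve_deriv (\<gamma> - \<delta>) t = curve_deriv \<gamma> t - curve_deriv \<delta> t"
    and "curve_deriv (c *\<^sub>R \<gamma>) t = c *\<^sub>R curve_deriv \<gamma> t"
proof -
  note * = curve_has_deriv[OF assms]
  have **: "curve 0 = (\<lambda>_. 0)" "curve (\<gamma> + \<delta>) = (\<lambda>t. curve \<gamma> t + curve \<delta> t)"
    "curve (\<gamma> - \<delta>) = (\<lambda>t. curve \<gamma> t - curve \<delta> t)"
    "curve (c *\<^sub>R \<gamma>) = (\<lambda>t. c *\<^sub>R curve \<gamma> t)"
    by (simp_all add: fun_eq_iff)
  show "curve_deriv 0 t = 0"
    by (rule curve_derivI[OF _ assms]) (simp add: **)
  show "curve_deriv (\<gamma> + \<delta>) t = curve_deriv \<gamma> t + curve_deriv \<delta> t"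
    by (rule curve_derivI[OF _ assms]) (unfold **, intro has_vector_derivative_add *)
  show "curve_deriv (\<gamma> - \<delta>) t = curve_deriv \<gamma> t - curve_deriv \<delta> t"
    by (rule curve_derivI[OF _ assms]) (unfold **, intro has_vector_derivative_diff *)
  show "curve_deriv (c *\<^sub>R \<gamma>) t = c *\<^sub>R curve_deriv \<gamma> t"
    by (rule curve_derivI[OF _ assms])
      (unfold **, intro bounded_linear.has_vector_derivative[OF bounded_linear_scaleR_right] *)
qed

lemma bdd_above_norm_01:
  fixes f :: "real \<Rightarrow> 'a::real_normed_vector"
  shows "continuous_on {0..1} f \<Longrightarrow> bdd_above ((\<lambda>t. norm (f t)) ` {0..1})"
  by (intro bounded_imp_bdd_above compact_imp_bounded compact_continuous_image continuous_intros)
    auto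

instantiation c1_curve :: (real_normed_vector) real_normed_vector
begin

definition norm_c1_curve :: "'a c1_curve \<Rightarrow> real" where
  "norm_c1_curve \<gamma> = (SUP t\<in>{0..1}. norm (curve \<gamma> t)) + (SUP t\<in>{0..1}. norm (curve_deriv \<gamma> t))"

definition dist_c1_curve :: "'a c1_curve \<Rightarrow> 'a c1_curve \<Rightarrow> real" where
  "dist_c1_curve \<gamma> \<delta> = norm (\<gamma> - \<delta>)"

definition sgn_c1_curve :: "'a c1_curve \<Rightarrow> 'a c1_curve" where
  "sgn_c1_curve \<gamma> = \<gamma> /\<^sub>R norm \<gamma>"

definition uniformity_c1_curve :: "('a c1_curve \<times> 'a c1_curve) filter" where
  "uniformity_c1_curve = (INF e\<in>{0<..}. principal {(\<gamma>, \<delta>). dist \<gamma> \<delta> < e})"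

definition open_c1_curve :: "'a c1_curve set \<Rightarrow> bool" where
  "open_c1_curve U \<longleftrightarrow> (\<forall>\<gamma>\<in>U. \<forall>\<^sub>F (\<gamma>', \<delta>) in uniformity. \<gamma>' = \<gamma> \<longrightarrow> \<delta> \<in> U)"

lemma norm_le_sup_curve:
  "t \<in> {0..1} \<Longrightarrow> norm (curve \<gamma> t) \<le> (SUP t\<in>{0..1}. norm (curve \<gamma> t))"
  by (rule cSUP_upper[OF _ bdd_above_norm_01[OF continuous_on_curve]])

lemma norm_le_sup_curve_deriv:
  "t \<in> {0..1} \<Longrightarrow> norm (curve_deriv \<gamma> t) \<le> (SUP t\<in>{0..1}. norm (curve_deriv \<gamma> t))"
  by (rule cSUP_upper[OF _ bdd_above_norm_01[OF continuous_on_curve_deriv]])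

lemma sup_curve_nonneg:
  "0 \<le> (SUP t\<in>{0..1}. norm (curve \<gamma> t))" "0 \<le> (SUP t\<in>{0..1}. norm (curve_deriv \<gamma> t))"
  by (rule order_trans[OF norm_ge_zero norm_le_sup_curve[of 0]], simp)
    (rule order_trans[OF norm_ge_zero norm_le_sup_curve_deriv[of 0]], simp)

lemma norm_c1_curve_le:
  assumes "\<And>t. t \<in> {0..1} \<Longrightarrow> norm (curve \<gamma> t) \<le> a"
    and "\<And>t. t \<in> {0..1} \<Longrightarrow> norm (curve_deriv \<gamma> t) \<le> b"
  shows "norm \<gamma> \<le> a + b"
  unfolding norm_c1_curve_def by (intro add_mono cSUP_least assms) auto

lemma norm_curve_le: "t \<in> {0..1} \<Longrightarrow> norm (curve \<gamma> t) \<le> norm \<gamma>"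
  unfolding norm_c1_curve_def using norm_le_sup_curve[of t \<gamma>] sup_curve_nonneg[of \<gamma>] by linarith

lemma norm_curve_deriv_le: "t \<in> {0..1} \<Longrightarrow> norm (curve_deriv \<gamma> t) \<le> norm \<gamma>"
  unfolding norm_c1_curve_def using norm_le_sup_curve_deriv[of t \<gamma>] sup_curve_nonneg[of \<gamma>]
  by linarith

instance
proof
  fix \<gamma> \<delta> :: "'a c1_curve" and c :: real
  show "norm \<gamma> = 0 \<longleftrightarrow> \<gamma> = 0"
  proof
    assume "norm \<gamma> = 0"
    then show "\<gamma> = 0"
      using norm_curve_le[of _ \<gamma>] by (intro c1_curve_eqI) simp
  next
    assume "\<gamma> = 0"
    then have "norm \<gamma> \<le> 0 + 0" by (intro norm_c1_curve_le) auto
    moreover have "0 \<le> norm \<gamma>" using sup_curve_nonneg[of \<gamma>] by (simp add: norm_c1_curve_def)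
    ultimately show "norm \<gamma> = 0" by simp
  qed
  have "norm (\<gamma> + \<delta>) \<le>
      ((SUP t\<in>{0..1}. norm (curve \<gamma> t)) + (SUP t\<in>{0..1}. norm (curve \<delta> t))) +
      ((SUP t\<in>{0..1}. norm (curve_deriv \<gamma> t)) + (SUP t\<in>{0..1}. norm (curve_deriv \<delta> t)))"
    by (intro norm_c1_curve_le)
      (auto intro!: norm_triangle_le add_mono norm_le_sup_curve norm_le_sup_curve_deriv)
  then show "norm (\<gamma> + \<delta>) \<le> norm \<gamma> + norm \<delta>"
    by (simp add: norm_c1_curve_def)
  have le: "norm (c *\<^sub>R \<gamma>) \<le> \<bar>c\<bar> * norm \<gamma>" for c and \<gamma> :: "'a c1_curve"
    unfolding norm_c1_curve_def[of \<gamma>] distrib_left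
    by (intro norm_c1_curve_le)
      (auto intro!: mult_left_mono norm_le_sup_curve norm_le_sup_curve_deriv)
  show "norm (c *\<^sub>R \<gamma>) = \<bar>c\<bar> * norm \<gamma>"
  proof (cases "c = 0")
    case True
    then show ?thesis using le[of 0 \<gamma>] sup_curve_nonneg[of 0] by (simp add: norm_c1_curve_def)
  next
    case False
    then have "\<bar>c\<bar> * norm \<gamma> \<le> norm (c *\<^sub>R \<gamma>)"
      using le[of "inverse c" "c *\<^sub>R \<gamma>"] by (simp add: field_simps)
    with le[of c \<gamma>] show ?thesis by simp
  qed
qed (simp_all add: dist_c1_curve_def sgn_c1_curve_def uniformity_c1_curve_def open_c1_curve_def)

end

instance c1_curve :: (banach) banach
proof
  fix X :: "nat \<Rightarrow> 'a c1_curve"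
  assume "Cauchy X"
  have small: "norm (curve (X m) t - curve (X n) t) \<le> dist (X m) (X n)"
      "norm (curve_deriv (X m) t - curve_deriv (X n) t) \<le> dist (X m) (X n)"
    if "t \<in> {0..1}" for m n t
    using norm_curve_le[OF that, of "X m - X n"] norm_curve_deriv_le[OF that, of "X m - X n"] that
    by (simp_all add: dist_norm)
  have "uniformly_Cauchy_on {0..1} (\<lambda>n. curve (X n))"
    "uniformly_Cauchy_on {0..1} (\<lambda>n. curve_deriv (X n))"
    using \<open>Cauchy X\<close> small unfolding uniformly_Cauchy_on_def Cauchy_def dist_norm[where 'a='a]
    by (meson le_less_trans)+
  then obtain f D where
    f: "uniform_limit {0..1} (\<lambda>n. curve (X n)) f sequentially" and
    D: "uniform_limit {0..1} (\<lambda>n. curve_deriv (X n)) D sequentially"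
    using Cauchy_uniformly_convergent by (metis uniformly_convergent_on_def)
  have contD: "continuous_on {0..1} D"
    by (rule uniform_limit_theorem[OF _ D]) (simp_all add: continuous_on_curve_deriv)
  have "\<exists>g. \<forall>t\<in>{0..1}. (\<lambda>n. curve (X n) t) \<longlonglongrightarrow> g t \<and>
      (g has_derivative (\<lambda>h. h *\<^sub>R D t)) (at t within {0..1})"
  proof (rule has_derivative_sequence[where f = "\<lambda>n. curve (X n)" and ?x0.0 = 0 and l = "f 0"
        and f' = "\<lambda>n t h. h *\<^sub>R curve_deriv (X n) t"])
    show "((curve (X n)) has_derivative (\<lambda>h. h *\<^sub>R curve_deriv (X n) t)) (at t within {0..1})"
      if "t \<in> {0..1}" for n t
      using curve_has_deriv[OF that] by (simp add: has_vector_derivative_def)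
    show "(\<lambda>n. curve (X n) 0) \<longlonglongrightarrow> f 0"
      using tendsto_uniform_limitI[OF f] by simp
    fix e :: real assume "e > 0"
    show "\<forall>\<^sub>F n in sequentially. \<forall>t\<in>{0..1}. \<forall>h.
        norm (h *\<^sub>R curve_deriv (X n) t - h *\<^sub>R D t) \<le> e * norm h"
      using uniform_limitD[OF D \<open>e > 0\<close>]
      by eventually_elim
        (auto simp: dist_norm mult.commute[of e] simp flip: scaleR_diff_right
          intro!: mult_left_mono intro: less_imp_le)
  qed auto
  then obtain g where g: "\<And>t. t \<in> {0..1} \<Longrightarrow> (\<lambda>n. curve (X n) t) \<longlonglongrightarrow> g t"
    "\<And>t. t \<in> {0..1} \<Longrightarrow> (g has_vector_derivative D t) (at t within {0..1})"
    unfolding has_vector_derivative_def by blast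
  obtain \<gamma> where \<gamma>: "\<And>t. t \<in> {0..1} \<Longrightarrow> curve \<gamma> t = g t"
    "\<And>t. t \<in> {0..1} \<Longrightarrow> curve_deriv \<gamma> t = D t"
    using c1_curve_exists[OF g(2) contD] by blast
  have gf: "g t = f t" if "t \<in> {0..1}" for t
    using LIMSEQ_unique[OF g(1)[OF that] tendsto_uniform_limitI[OF f that]] .
  have "X \<longlonglongrightarrow> \<gamma>"
  proof (rule tendstoI)
    fix e :: real assume "e > 0"
    then have "e / 3 > 0" by simp
    from uniform_limitD[OF f this] uniform_limitD[OF D this]
    show "\<forall>\<^sub>F n in sequentially. dist (X n) \<gamma> < e"
    proof eventually_elim
      case (elim n)
      have "norm (X n - \<gamma>) \<le> e / 3 + e / 3"
        using elim by (intro norm_c1_curve_le) (auto simp: \<gamma> gf dist_norm less_imp_le)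
      with \<open>e > 0\<close> show ?case by (simp add: dist_norm)
    qed
  qed
  then show "convergent X" by (rule convergentI)
qed

end

theory Submission
  imports Defs
begin

text \<open>
  The set \<open>A\<close> is the intersection of a null set \<open>G\<close>, which swallows generic curves completely, with a
  cylinder \<open>F \<times> \<real>\<close>, which makes the intersection porous without making it thin.

  \<^item> \<open>C\<^sup>1([0,1])\<close> is separable (\<open>countable_dense_c1_curves\<close>), and the image of one \<open>C\<^sup>1\<close> curve in the
    plane is null. So the union of the images of a countable dense family of curves is null, and it
    lies in open sets \<open>T\<^sub>n\<close> of measure tending to \<open>0\<close>. The curves with image in \<open>T\<^sub>n\<close> form an open set,
    because images are compact, and a dense one, because it contains the family. Hence a generic
    curve lies in the null set \<open>G = \<Inter>\<^sub>n T\<^sub>n\<close> (\<open>residual_c1_curves_into_null_set\<close>).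

  \<^item> On the line there is a power-\<open>p\<close>-porous set of positive measure
    (\<open>power_porous_set_of_positive_measure\<close>). A hole at distance at most \<open>1/m\<close> from every point needs
    only a radius of order \<open>m\<^sup>-\<^sup>p\<close>, so the \<open>m + 1\<close> holes of the grid of mesh \<open>1/m\<close> have total length of
    order \<open>m\<^sup>1\<^sup>-\<^sup>p\<close>. This tends to \<open>0\<close> as \<open>p > 1\<close>, so it can be made summable with a small sum along
    infinitely many grids. The cylinder over such a set \<open>F\<close> is porous in the plane with the same
    exponent, and porosity passes to subsets.

  Let \<open>\<gamma>\<close> be a curve in \<open>G\<close> that is uniformly close to the segment \<open>t \<mapsto> (t, 0)\<close>. The times at which
  \<open>\<gamma>\<close> is in \<open>A\<close> are those at which its first coordinate is in \<open>F\<close>. By the intermediate value theorem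
  the first coordinate maps these times onto \<open>F\<close>, and a differentiable function maps null sets to null
  sets, so the times do not form a null set. If the curves with a null set of times were residual, one
  of them would, by the Baire category theorem, lie in \<open>G\<close> and in the ball around the segment.
\<close>

section \<open>Baire category\<close>

lemma open_meets_residual_Int:
  fixes U S T :: "'a::complete_space set"
  assumes "residual S" "residual T" "open U" "U \<noteq> {}"
  shows "U \<inter> S \<inter> T \<noteq> {}"
proof -
  obtain M N :: "nat \<Rightarrow> 'a set" where M: "\<And>n. nowhere_dense (M n)" "- S = (\<Union>n. M n)"
    and N: "\<And>n. nowhere_dense (N n)" "- T = (\<Union>n. N n)"
    using assms(1,2) unfolding residual_def meagre_def by metis
  let ?\<G> = "range (\<lambda>n. closure (M n)) \<union> range (\<lambda>n. closure (N n))"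
  have "euclidean interior_of \<Union>?\<G> = {}"
  proof (rule Baire_category_alt)
    show "closedin euclidean C \<and> euclidean interior_of C = {}" if "C \<in> ?\<G>" for C
      using that M(1) N(1) unfolding nowhere_dense_def by auto
  qed (auto simp: completely_metrizable_space_euclidean)
  then have "interior (\<Union>?\<G>) = {}" by simp
  then have "\<not> U \<subseteq> \<Union>?\<G>"
    using assms(3,4) interior_maximal[of U "\<Union>?\<G>"] by auto
  moreover have "- S \<union> - T \<subseteq> \<Union>?\<G>"
  proof -
    have "M n \<subseteq> \<Union>?\<G>" "N n \<subseteq> \<Union>?\<G>" for n
      using closure_subset[of "M n"] closure_subset[of "N n"] by auto
    then show ?thesis unfolding M(2) N(2) by (intro Un_least UN_least)
  qed
  ultimately show ?thesis by blast
qed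

lemma nowhere_dense_Compl_open_dense:
  fixes W :: "'a::topological_space set"
  assumes "open W" "closure W = UNIV"
  shows "nowhere_dense (- W)"
  using assms by (simp add: nowhere_dense_def interior_complement closed_Compl)

text \<open>
  Both constructions below discretise the unit interval: derivatives of curves are sampled on a grid,
  and holes are drilled at the points of a grid. The index \<open>N\<close> occurs only for \<open>t = 1\<close>.
\<close>

lemma unit_interval_grid:
  fixes t :: real and N :: nat
  assumes "t \<in> {0..1}" "N > 0"
  shows "nat \<lfloor>t * N\<rfloor> \<le> N" "\<bar>t - nat \<lfloor>t * N\<rfloor> / N\<bar> < 1 / N"
proof -
  define k where "k = nat \<lfloor>t * N\<rfloor>"
  have "t * N \<le> N" using assms(1) by (intro mult_left_le_one_le) auto
  moreover have "0 \<le> t * N" using assms(1) by simp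
  ultimately have k: "k \<le> N" "real k \<le> t * N" "t * N < real k + 1"
    unfolding k_def by linarith+
  have "t - k / N = (t * N - k) / N" using assms(2) by (simp add: diff_divide_distrib)
  then have "\<bar>t - k / N\<bar> = \<bar>t * N - k\<bar> / N" by (simp only: abs_divide abs_of_nat)
  also have "\<dots> < 1 / N" using k(2,3) assms(2) by (intro divide_strict_right_mono) auto
  finally show "\<bar>t - nat \<lfloor>t * N\<rfloor> / N\<bar> < 1 / N" unfolding k_def .
  show "nat \<lfloor>t * N\<rfloor> \<le> N" using k(1) unfolding k_def .
qed

section \<open>Generic curves stay in a null set\<close>

text \<open>
  By the mean value inequality a \<open>C\<^sup>1\<close> curve is controlled by its initial value and its derivative.
  Approximation in \<open>C\<^sup>1\<close> thereby reduces to uniform approximation of the derivative.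
\<close>

lemma c1_curve_norm_le_deriv:
  fixes \<gamma> :: "'a::real_normed_vector c1_curve"
  assumes "norm (curve \<gamma> 0) \<le> a" "\<And>t. t \<in> {0..1} \<Longrightarrow> norm (curve_deriv \<gamma> t) \<le> b"
  shows "norm \<gamma> \<le> a + 2 * b"
proof -
  have "norm (curve \<gamma> t) \<le> a + b" if t: "t \<in> {0..1}" for t
  proof -
    have "norm (curve \<gamma> t - curve \<gamma> 0) \<le> b * norm (t - 0)"
    proof (rule differentiable_bound[of "{0..1}" "curve \<gamma>" "\<lambda>s h. h *\<^sub>R curve_deriv \<gamma> s"])
      show "(curve \<gamma> has_derivative (\<lambda>h. h *\<^sub>R curve_deriv \<gamma> s)) (at s within {0..1})"
        if "s \<in> {0..1}" for s
        using curve_has_deriv[OF that] by (simp add: has_vector_derivative_def)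
      show "onorm (\<lambda>h. h *\<^sub>R curve_deriv \<gamma> s) \<le> b" if "s \<in> {0..1}" for s
        using assms(2)[OF that] by (intro onorm_le) (simp add: mult.commute[of b] mult_left_mono)
    qed (use t in auto)
    moreover have "0 \<le> b" using order_trans[OF norm_ge_zero assms(2)[of 0]] by simp
    then have "b * norm (t - 0) \<le> b" using t by (simp add: mult_left_le)
    ultimately show ?thesis
      using norm_triangle_sub[of "curve \<gamma> t" "curve \<gamma> 0"] assms(1) by linarith
  qed
  then have "norm \<gamma> \<le> (a + b) + b" using assms(2) by (rule norm_c1_curve_le)
  then show ?thesis by simp
qed

text \<open>
  Separability without explicit approximants. A datum \<open>(m, c, ds)\<close> consists of a tolerance \<open>1/(m+1)\<close>,
  an initial value and the values of a step function, all taken from a countable dense set; a curve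
  fits it if its initial value and its derivative are within the tolerance. There are countably many
  data. Choosing one fitting curve for each datum gives a dense set: as the derivative of a given curve
  is uniformly continuous, the curve fits a datum with any prescribed tolerance, and two curves that
  fit the same datum are close.
\<close>

lemma countable_dense_c1_curves:
  obtains C :: "'a::{real_normed_vector, second_countable_topology} c1_curve set"
  where "countable C" "closure C = UNIV"
proof -
  obtain D :: "'a set" where "countable D"
    and D: "\<And>X. open X \<Longrightarrow> X \<noteq> {} \<Longrightarrow> \<exists>d\<in>D. d \<in> X"
    using countable_dense_setE by blast
  define fits :: "nat \<times> 'a \<times> 'a list \<Rightarrow> 'a c1_curve \<Rightarrow> bool" where
    "fits = (\<lambda>(m, c, ds) \<gamma>. norm (curve \<gamma> 0 - c) < 1 / Suc m \<and>
      (\<forall>t\<in>{0..1}. norm (curve_deriv \<gamma> t - ds ! nat \<lfloor>t * (real (length ds) - 1)\<rfloor>) < 1 / Suc m))"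
  let ?I = "UNIV \<times> D \<times> lists D :: (nat \<times> 'a \<times> 'a list) set"
  define C where "C = (\<lambda>i. SOME \<gamma>. fits i \<gamma>) ` ?I"
  have "countable C"
    unfolding C_def using \<open>countable D\<close> by (intro countable_image countable_SIGMA) auto
  have "\<exists>\<delta>\<in>C. dist \<delta> \<gamma> < \<epsilon>" if "\<epsilon> > 0" for \<gamma> and \<epsilon> :: real
  proof -
    \<comment> \<open>Two curves that fit the same datum with tolerance \<open>\<eta>\<close> differ by at most \<open>2 \<eta>\<close> at \<open>0\<close> and in the
      derivative, hence by at most \<open>2 \<eta> + 2 (2 \<eta>) = 6 \<eta>\<close> in norm.\<close>
    obtain m where m: "1 / Suc m < \<epsilon> / 6"
      using nat_approx_posE[of "\<epsilon> / 6"] \<open>\<epsilon> > 0\<close> by auto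
    define \<eta> where "\<eta> = 1 / Suc m"
    have "\<eta> > 0" "6 * \<eta> < \<epsilon>" using m by (auto simp: \<eta>_def)
    have approx: "\<exists>d\<in>D. norm (x - d) < \<eta> / 2" for x
      using D[of "ball x (\<eta> / 2)"] \<open>\<eta> > 0\<close> by (auto simp: dist_norm)
    then obtain q where q: "\<And>x. q x \<in> D" "\<And>x. norm (x - q x) < \<eta> / 2" by metis
    have "uniformly_continuous_on {0..1} (curve_deriv \<gamma>)"
      by (intro compact_uniformly_continuous continuous_on_curve_deriv) auto
    then obtain \<rho> where "\<rho> > 0" and \<rho>: "\<And>s t. s \<in> {0..1} \<Longrightarrow> t \<in> {0..1} \<Longrightarrow> dist s t < \<rho> \<Longrightarrow>
        dist (curve_deriv \<gamma> s) (curve_deriv \<gamma> t) < \<eta> / 2"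
      unfolding uniformly_continuous_on_def using \<open>\<eta> > 0\<close> by (metis half_gt_zero)
    obtain n where n: "1 / real (Suc n) < \<rho>"
      using nat_approx_posE[OF \<open>\<rho> > 0\<close>] by blast
    \<comment> \<open>There is one sample for each of the \<open>n + 2\<close> points of the grid of mesh \<open>1 / (n + 1)\<close>.\<close>
    define ds where "ds = map (\<lambda>k. q (curve_deriv \<gamma> (real k / Suc n))) [0..<Suc (Suc n)]"
    have len: "real (length ds) - 1 = Suc n" by (simp add: ds_def)
    have "norm (curve_deriv \<gamma> t - ds ! nat \<lfloor>t * Suc n\<rfloor>) < \<eta>" if t: "t \<in> {0..1}" for t
    proof -
      define k where "k = nat \<lfloor>t * Suc n\<rfloor>"
      let ?s = "real k / Suc n"
      have "k \<le> Suc n" "\<bar>t - ?s\<bar> < 1 / Suc n"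
        using unit_interval_grid[OF t, of "Suc n"] unfolding k_def by auto
      then have "?s \<in> {0..1}" by (simp add: divide_le_eq)
      have "dist (curve_deriv \<gamma> t) (curve_deriv \<gamma> ?s) < \<eta> / 2"
        using \<rho>[OF t \<open>?s \<in> {0..1}\<close>] \<open>\<bar>t - ?s\<bar> < 1 / Suc n\<close> n by (simp add: dist_real_def)
      moreover have "ds ! k = q (curve_deriv \<gamma> ?s)"
        using \<open>k \<le> Suc n\<close> unfolding ds_def by (simp add: nth_map del: upt_Suc)
      ultimately have "norm (curve_deriv \<gamma> t - ds ! k) < \<eta> / 2 + \<eta> / 2"
        using norm_diff_triangle_less[OF _ q(2)] by (simp only: dist_norm)
      then show ?thesis unfolding k_def by simp
    qed
    moreover have "norm (curve \<gamma> 0 - q (curve \<gamma> 0)) < \<eta>"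
      using q(2)[of "curve \<gamma> 0"] \<open>\<eta> > 0\<close> by linarith
    ultimately have \<gamma>: "fits (m, q (curve \<gamma> 0), ds) \<gamma>"
      by (simp add: fits_def len \<eta>_def del: of_nat_Suc)
    define \<delta> where "\<delta> = (SOME \<delta>. fits (m, q (curve \<gamma> 0), ds) \<delta>)"
    have \<delta>: "fits (m, q (curve \<gamma> 0), ds) \<delta>" unfolding \<delta>_def using \<gamma> by (rule someI)
    have "\<delta> \<in> C"
      unfolding C_def \<delta>_def using q(1) by (intro imageI) (auto simp: ds_def)
    have tri: "norm (x - y) \<le> 2 * \<eta>" if "norm (x - z) < \<eta>" "norm (y - z) < \<eta>" for x y z :: 'a
      using norm_triangle_ineq4[of "x - z" "y - z"] that by simp
    have fits: "norm (curve \<delta> 0 - q (curve \<gamma> 0)) < \<eta>"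
        "\<And>t. t \<in> {0..1} \<Longrightarrow> norm (curve_deriv \<delta> t - ds ! nat \<lfloor>t * (real (length ds) - 1)\<rfloor>) < \<eta>"
      if "fits (m, q (curve \<gamma> 0), ds) \<delta>" for \<delta>
      using that by (auto simp: fits_def \<eta>_def)
    have "norm (\<delta> - \<gamma>) \<le> 2 * \<eta> + 2 * (2 * \<eta>)"
    proof (rule c1_curve_norm_le_deriv)
      show "norm (curve (\<delta> - \<gamma>) 0) \<le> 2 * \<eta>"
        using tri[OF fits(1)[OF \<delta>] fits(1)[OF \<gamma>]] by simp
      show "norm (curve_deriv (\<delta> - \<gamma>) t) \<le> 2 * \<eta>" if "t \<in> {0..1}" for t
        using tri[OF fits(2)[OF \<delta> that] fits(2)[OF \<gamma> that]] that by simp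
    qed
    then have "dist \<delta> \<gamma> < \<epsilon>" using \<open>6 * \<eta> < \<epsilon>\<close> by (simp add: dist_norm)
    then show ?thesis using \<open>\<delta> \<in> C\<close> by blast
  qed
  then have "closure C = UNIV" by (auto simp: closure_approachable)
  with \<open>countable C\<close> show ?thesis by (rule that)
qed

lemma open_c1_curves_into:
  fixes G :: "'a::real_normed_vector set"
  assumes "open G"
  shows "open {\<gamma>. curve \<gamma> ` {0..1} \<subseteq> G}"
proof (unfold open_dist, intro ballI)
  fix \<gamma> assume "\<gamma> \<in> {\<gamma>. curve \<gamma> ` {0..1} \<subseteq> G}"
  moreover have "compact (curve \<gamma> ` {0..1})"
    by (intro compact_continuous_image continuous_on_curve) auto
  ultimately obtain e where "e > 0" and e: "(\<Union>x\<in>curve \<gamma> ` {0..1}. ball x e) \<subseteq> G"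
    using compact_subset_open_imp_ball_epsilon_subset[OF _ assms] by blast
  have "curve \<delta> t \<in> G" if "dist \<delta> \<gamma> < e" "t \<in> {0..1}" for \<delta> t
  proof -
    have "dist (curve \<gamma> t) (curve \<delta> t) < e"
      using norm_curve_le[OF that(2), of "\<delta> - \<gamma>"] that(1) by (simp add: dist_norm norm_minus_commute)
    then have "curve \<delta> t \<in> ball (curve \<gamma> t) e" by simp
    then show ?thesis using e that(2) by blast
  qed
  then show "\<exists>e>0. \<forall>\<delta>. dist \<delta> \<gamma> < e \<longrightarrow> \<delta> \<in> {\<gamma>. curve \<gamma> ` {0..1} \<subseteq> G}"
    using \<open>e > 0\<close> by (intro exI[of _ e]) auto
qed

lemma negligible_c1_curve_image:
  fixes \<gamma> :: "'a::euclidean_space c1_curve"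
  assumes "DIM('a) \<ge> 2"
  shows "negligible (curve \<gamma> ` {0..1})"
proof (rule negligible_differentiable_image_lowdim)
  show "curve \<gamma> differentiable_on {0..1}"
    unfolding differentiable_on_def by (auto intro!: differentiableI_vector curve_has_deriv)
qed (use assms in simp)

lemma negligible_subset_small_open:
  fixes S :: "'a::euclidean_space set"
  assumes "negligible S" "e > 0"
  obtains T where "open T" "S \<subseteq> T" "emeasure lebesgue T < ennreal e"
proof -
  have S: "S \<in> null_sets lebesgue" using assms(1) by (simp add: negligible_iff_null_sets)
  obtain T where T: "open T" "S \<subseteq> T" "emeasure lebesgue (T - S) < ennreal e"
    by (rule sets_lebesgue_outer_open[OF null_setsD2[OF S] assms(2)])
  moreover have "emeasure lebesgue (T - S) = emeasure lebesgue T"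
    using S T(1) by (intro emeasure_Diff_null_set) auto
  ultimately show ?thesis using that by simp
qed

text \<open>
  One null set contains the complete image of a generic curve. A single curve has a null image, so this
  holds for the curves of a countable dense family jointly; passing to a \<open>G\<^sub>\<delta>\<close> null set around these
  images turns density into genericity.
\<close>

lemma residual_c1_curves_into_null_set:
  assumes "DIM('a) \<ge> 2"
  obtains G :: "'a::euclidean_space set" where "negligible G" "residual {\<gamma>. curve \<gamma> ` {0..1} \<subseteq> G}"
proof -
  obtain C :: "'a c1_curve set" where C: "countable C" "closure C = UNIV"
    using countable_dense_c1_curves .
  have "negligible (\<Union>\<gamma>\<in>C. curve \<gamma> ` {0..1})"
    using C(1) assms by (intro negligible_countable_Union) (auto simp: negligible_c1_curve_image)
  then have "\<exists>T. open T \<and> (\<Union>\<gamma>\<in>C. curve \<gamma> ` {0..1}) \<subseteq> T \<and> emeasure lebesgue T < ennreal (1 / Suc n)" for n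
    by (rule negligible_subset_small_open[of _ "1 / Suc n"]) auto
  then obtain T where T: "\<And>n. open (T n)" "\<And>n. (\<Union>\<gamma>\<in>C. curve \<gamma> ` {0..1}) \<subseteq> T n"
      "\<And>n. emeasure lebesgue (T n) < ennreal (1 / Suc n)"
    by metis
  show ?thesis
  proof
    have sets: "(\<Inter>n. T n) \<in> sets lebesgue" using T(1) by (intro sets.countable_INT) auto
    have le: "emeasure lebesgue (\<Inter>n. T n) \<le> ennreal e" if e: "e > 0" for e
    proof -
      obtain n where "1 / real (Suc n) < e" using nat_approx_posE[OF e] by blast
      moreover have "emeasure lebesgue (\<Inter>n. T n) \<le> emeasure lebesgue (T n)"
        using T(1) by (intro emeasure_mono) auto
      ultimately show ?thesis
        using T(3)[of n] by (meson ennreal_leI less_imp_le order_trans)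
    qed
    have "emeasure lebesgue (\<Inter>n. T n) \<le> 0"
      by (rule ennreal_le_epsilon) (simp only: add_0 le)
    then show "negligible (\<Inter>n. T n)"
      using sets by (simp add: negligible_iff_null_sets null_setsI)
    let ?W = "\<lambda>n. {\<gamma>. curve \<gamma> ` {0..1} \<subseteq> T n}"
    have "nowhere_dense (- ?W n)" for n
    proof (rule nowhere_dense_Compl_open_dense)
      show "open (?W n)" using T(1) by (rule open_c1_curves_into)
      have "C \<subseteq> ?W n" using T(2) by blast
      then show "closure (?W n) = UNIV" using C(2) closure_mono by blast
    qed
    moreover have "- {\<gamma>. curve \<gamma> ` {0..1} \<subseteq> (\<Inter>n. T n)} = (\<Union>n. - ?W n)" by auto
    ultimately show "residual {\<gamma>. curve \<gamma> ` {0..1} \<subseteq> (\<Inter>n. T n)}"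
      unfolding residual_def meagre_def by (intro exI[of _ "\<lambda>n. - ?W n"]) auto
  qed
qed

section \<open>A power-porous set of positive measure on the line\<close>

lemma power_porous_subset:
  assumes "power_porous p P" "Q \<subseteq> P"
  shows "power_porous p Q"
  unfolding power_porous_def
proof
  fix x assume "x \<in> Q"
  then have P: "power_porous_at p P x" using assms by (auto simp: power_porous_def)
  show "power_porous_at p Q x"
    unfolding power_porous_at_def
  proof (intro allI impI)
    fix \<epsilon> :: real assume "\<epsilon> > 0"
    from P[unfolded power_porous_at_def, rule_format, OF this]
    obtain h r where h: "r > 0" "dist h x < \<epsilon>" "ball h r \<inter> P = {}" "r > dist h x powr p"
      by auto
    moreover have "ball h r \<inter> Q = {}" using h(3) assms(2) by blast
    ultimately show "\<exists>h r. r > 0 \<and> dist h x < \<epsilon> \<and> ball h r \<inter> Q = {} \<and> r > dist h x powr p"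
      by (intro exI[of _ h] exI[of _ r] conjI)
  qed
qed

text \<open>
  A hole of \<open>F\<close> gives a slab of the same half-width missing the cylinder. Moving a point only in the
  coordinate \<open>i\<close> reaches the centre of a ball in this slab, at the same distance as on the line.
\<close>

lemma power_porous_cylinder:
  fixes i :: "'n::finite"
  assumes "power_porous p F"
  shows "power_porous p {x :: real ^ 'n. x $ i \<in> F}"
  unfolding power_porous_def power_porous_at_def
proof (intro ballI allI impI)
  fix x :: "real ^ 'n" and \<epsilon> :: real assume x: "x \<in> {x. x $ i \<in> F}" "\<epsilon> > 0"
  then obtain h r where h: "r > 0" "dist h (x $ i) < \<epsilon>" "ball h r \<inter> F = {}" "r > dist h (x $ i) powr p"
    using assms unfolding power_porous_def power_porous_at_def by blast
  let ?h = "x + (h - x $ i) *\<^sub>R axis i 1"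
  have "dist ?h x = dist h (x $ i)" by (simp add: dist_norm)
  moreover have "ball ?h r \<inter> {x. x $ i \<in> F} = {}"
  proof -
    have "y $ i \<in> ball h r" if "y \<in> ball ?h r" for y
      using that dist_vec_nth_le[of ?h i y] by (simp add: axis_def)
    then show ?thesis using h(3) by blast
  qed
  ultimately show "\<exists>h r. r > 0 \<and> dist h x < \<epsilon> \<and> ball h r \<inter> {x. x $ i \<in> F} = {} \<and> r > dist h x powr p"
    using h by (intro exI[of _ ?h] exI[of _ r]) simp
qed

text \<open>
  From an interval, remove the balls of radius \<open>2 m\<^sup>-\<^sup>p\<close> around the points \<open>k/m\<close>, for a sequence of mesh
  sizes \<open>1/m\<close> tending to \<open>0\<close>. Each remaining point is within \<open>1/m\<close> of a removed ball's centre, which gives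
  porosity, whereas the balls for one \<open>m\<close> have total length at most \<open>8 m\<^sup>1\<^sup>-\<^sup>p\<close>, which is as small as
  desired for large \<open>m\<close>.
\<close>

lemma power_porous_set_of_positive_measure:
  fixes p a b :: real
  assumes "p > 1" "0 \<le> a" "a < b" "b \<le> 1"
  obtains F where "power_porous p F" "F \<subseteq> {a..b}" "\<not> negligible F"
proof -
  \<comment> \<open>The holes may use up half of the interval: \<open>c / 2\<^sup>n\<^sup>+\<^sup>1\<close> for the \<open>n\<close>-th grid.\<close>
  define c where "c = (b - a) / 2"
  have "c > 0" using assms by (simp add: c_def)
  have "\<exists>m::nat. m \<ge> Suc n \<and> 8 * real m powr (1 - p) \<le> c * (1 / 2) ^ Suc n" for n
  proof -
    have "((\<lambda>m::nat. 8 * real m powr (1 - p)) \<longlongrightarrow> 0) sequentially"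
      using \<open>p > 1\<close> by (intro tendsto_mult_right_zero tendsto_neg_powr filterlim_real_sequentially) auto
    moreover have "0 < c * (1 / 2) ^ Suc n" using \<open>c > 0\<close> by simp
    ultimately have "\<forall>\<^sub>F m in sequentially. 8 * real m powr (1 - p) < c * (1 / 2) ^ Suc n"
      by (rule order_tendstoD)
    with eventually_ge_at_top[of "Suc n"]
    have "\<forall>\<^sub>F m in sequentially. m \<ge> Suc n \<and> 8 * real m powr (1 - p) \<le> c * (1 / 2) ^ Suc n"
      by eventually_elim auto
    then show ?thesis using eventually_happens trivial_limit_sequentially by blast
  qed
  then obtain m :: "nat \<Rightarrow> nat" where m: "\<And>n. m n \<ge> Suc n"
    and small: "\<And>n. 8 * real (m n) powr (1 - p) \<le> c * (1 / 2) ^ Suc n"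
    by metis
  define r where "r n = 2 * real (m n) powr (- p)" for n
  define V where "V n = (\<Union>k\<le>m n. ball (real k / m n) (r n))" for n
  have mpos: "real (m n) > 0" for n using m[of n] by simp
  have rpos: "r n > 0" for n using mpos[of n] by (simp add: r_def)
  have V: "emeasure lebesgue (V n) \<le> ennreal (c * (1 / 2) ^ Suc n)" for n
  proof -
    have "emeasure lebesgue (V n) \<le> (\<Sum>k\<le>m n. emeasure lebesgue (ball (real k / m n) (r n)))"
      unfolding V_def by (intro emeasure_subadditive_finite) auto
    also have "\<dots> = (\<Sum>k\<le>m n. ennreal (2 * r n))"
      using rpos[of n] by (simp add: ball_eq_greaterThanLessThan)
    also have "\<dots> = ennreal ((real (m n) + 1) * (2 * r n))"
      using rpos[of n] by (subst sum_ennreal) (auto simp: algebra_simps)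
    also have "\<dots> \<le> ennreal (8 * real (m n) powr (1 - p))"
    proof (rule ennreal_leI)
      have "(real (m n) + 1) * (2 * r n) \<le> (2 * real (m n)) * (2 * r n)"
        using rpos[of n] m[of n] by (intro mult_right_mono) auto
      also have "\<dots> = 8 * real (m n) powr (1 - p)"
        using mpos[of n] by (simp add: r_def powr_diff powr_minus field_simps)
      finally show "(real (m n) + 1) * (2 * r n) \<le> 8 * real (m n) powr (1 - p)" .
    qed
    finally show ?thesis using small[of n] by (meson ennreal_leI order_trans)
  qed
  define F where "F = {a..b} - (\<Union>n. V n)"
  show ?thesis
  proof
    show "F \<subseteq> {a..b}" by (auto simp: F_def)
    show "power_porous p F"
      unfolding power_porous_def power_porous_at_def
    proof (intro ballI allI impI)
      fix x \<epsilon> :: real assume x: "x \<in> F" and "\<epsilon> > 0"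
      obtain n where n: "1 / real (Suc n) < \<epsilon>"
        using nat_approx_posE[OF \<open>\<epsilon> > 0\<close>] by blast
      define k where "k = nat \<lfloor>x * m n\<rfloor>"
      have x01: "0 \<le> x" "x \<le> 1" using x assms by (auto simp: F_def)
      let ?h = "real k / m n"
      have k: "k \<le> m n" and "\<bar>x - ?h\<bar> < 1 / m n"
        using unit_interval_grid[of x "m n"] x01 mpos[of n] unfolding k_def by auto
      then have d: "dist ?h x \<le> 1 / m n" by (simp add: dist_real_def abs_minus_commute)
      also have "1 / real (m n) \<le> 1 / Suc n" using m[of n] by (intro divide_left_mono) auto
      finally have "dist ?h x < \<epsilon>" using n by simp
      moreover have "ball ?h (r n) \<inter> F = {}" using k unfolding F_def V_def by blast
      moreover have "dist ?h x powr p < r n"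
      proof -
        have "dist ?h x powr p \<le> (1 / m n) powr p" using d \<open>p > 1\<close> by (intro powr_mono2) auto
        also have "\<dots> < r n" using mpos[of n] by (simp add: r_def powr_minus powr_divide field_simps)
        finally show ?thesis .
      qed
      ultimately show "\<exists>h r. r > 0 \<and> dist h x < \<epsilon> \<and> ball h r \<inter> F = {} \<and> r > dist h x powr p"
        using rpos by blast
    qed
    show "\<not> negligible F"
    proof
      assume "negligible F"
      then have F: "F \<in> null_sets lebesgue" by (simp add: negligible_iff_null_sets)
      have Vs: "V n \<in> sets lebesgue" for n unfolding V_def by auto
      have "emeasure lebesgue {a..b} \<le> emeasure lebesgue ((\<Union>n. V n) \<union> F)"
        using F Vs by (intro emeasure_mono sets.Un sets.countable_UN) (auto simp: F_def)
      also have "\<dots> = emeasure lebesgue (\<Union>n. V n)"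
        using F Vs by (intro emeasure_Un_null_set) auto
      also have "\<dots> \<le> (\<Sum>n. emeasure lebesgue (V n))"
        using Vs by (intro emeasure_subadditive_countably) auto
      also have "\<dots> \<le> (\<Sum>n. ennreal (c * (1 / 2) ^ Suc n))"
        using V by (intro suminf_le) auto
      also have "\<dots> = ennreal c"
        using sums_mult[OF power_half_series, of c] \<open>c > 0\<close>
        by (intro suminf_ennreal_eq) auto
      finally have "ennreal (b - a) \<le> ennreal c" using \<open>a < b\<close> by simp
      then show False using \<open>a < b\<close> by (simp add: c_def)
    qed
  qed
qed

section \<open>The exceptional set\<close>

theorem theorem4p4:
  fixes p :: real
  assumes "p > 1"
  shows "\<exists>A :: (real ^ 2) set. power_porous p A \<and> A \<in> null_sets lebesgue \<and>
    \<not> residual {\<gamma> :: (real ^ 2) c1_curve. outer_measure_of lebesgue {t \<in> {0..1}. curve \<gamma> t \<in> A} = 0}"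
proof -
  obtain F :: "real set" where F: "power_porous p F" "F \<subseteq> {1/4..3/4}" "\<not> negligible F"
    using power_porous_set_of_positive_measure[OF assms, of "1/4" "3/4"] by auto
  obtain G :: "(real ^ 2) set" where G: "negligible G" "residual {\<gamma>. curve \<gamma> ` {0..1} \<subseteq> G}"
    using residual_c1_curves_into_null_set[where 'a = "real ^ 2"] by auto
  define A where "A = {x :: real ^ 2. x $ 1 \<in> F} \<inter> G"
  let ?S = "{\<gamma> :: (real ^ 2) c1_curve. outer_measure_of lebesgue {t \<in> {0..1}. curve \<gamma> t \<in> A} = 0}"
  have "power_porous p A"
    unfolding A_def by (rule power_porous_subset[OF power_porous_cylinder[OF F(1)]]) auto
  moreover have "A \<in> null_sets lebesgue"
    using G(1) negligible_subset[of G A] unfolding A_def negligible_iff_null_sets[symmetric] by blast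
  moreover have "\<not> residual ?S"
  proof
    assume "residual ?S"
    obtain \<sigma> :: "(real ^ 2) c1_curve" where \<sigma>: "\<And>t. t \<in> {0..1} \<Longrightarrow> curve \<sigma> t = t *\<^sub>R axis 1 1"
    proof (rule c1_curve_exists[of "\<lambda>t. t *\<^sub>R axis 1 1 :: real ^ 2" "\<lambda>_. axis 1 1"])
      show "((\<lambda>t. t *\<^sub>R axis 1 1 :: real ^ 2) has_vector_derivative axis 1 1) (at t within {0..1})" for t
        by (auto intro!: derivative_eq_intros)
    qed (auto intro: that)
    have "ball \<sigma> (1/4) \<inter> ?S \<inter> {\<gamma>. curve \<gamma> ` {0..1} \<subseteq> G} \<noteq> {}"
      using \<open>residual ?S\<close> G(2) by (intro open_meets_residual_Int) auto
    then obtain \<gamma> where near: "dist \<sigma> \<gamma> < 1/4" and "\<gamma> \<in> ?S" and G\<gamma>: "curve \<gamma> ` {0..1} \<subseteq> G"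
      by auto
    define f where "f t = curve \<gamma> t $ 1" for t
    let ?E = "{t \<in> {0..1}. curve \<gamma> t \<in> A}"
    have close: "\<bar>f t - t\<bar> < 1/4" if "t \<in> {0..1}" for t
    proof -
      have "\<bar>f t - t\<bar> = \<bar>curve (\<sigma> - \<gamma>) t $ 1\<bar>" using \<sigma>[OF that] by (simp add: f_def axis_def abs_minus_commute)
      also have "\<dots> \<le> norm (curve (\<sigma> - \<gamma>) t)" by (rule component_le_norm_cart)
      also have "\<dots> \<le> norm (\<sigma> - \<gamma>)" using that by (rule norm_curve_le)
      finally show ?thesis using near by (simp add: dist_norm)
    qed
    have "continuous_on {0..1} f"
      unfolding f_def by (intro continuous_intros continuous_on_curve)
    \<comment> \<open>\<open>\<gamma>\<close> stays in \<open>G\<close>, so it is in \<open>A\<close> as soon as \<open>f\<close> is in \<open>F\<close>, and \<open>f\<close> passes through all of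
      \<open>[1/4, 3/4]\<close>.\<close>
    have "F \<subseteq> f ` ?E"
    proof
      fix y assume "y \<in> F"
      then have "1/4 \<le> y" "y \<le> 3/4" using F(2) by auto
      moreover have "f 0 < 1/4" "3/4 < f 1" using close[of 0] close[of 1] unfolding abs_less_iff by auto
      ultimately have "f 0 \<le> y" "y \<le> f 1" by linarith+
      then obtain t where "t \<in> {0..1}" "f t = y"
        using IVT'[of f 0 y 1] \<open>continuous_on {0..1} f\<close> by auto
      then show "y \<in> f ` ?E"
        using \<open>y \<in> F\<close> G\<gamma> by (force simp: A_def f_def)
    qed
    moreover have "negligible (f ` ?E)"
    proof (rule negligible_differentiable_image_negligible)
      obtain E where "E \<in> sets lebesgue" "?E \<subseteq> E" "outer_measure_of lebesgue ?E = emeasure lebesgue E"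
        using outer_measure_of_attain[of ?E lebesgue] by auto
      then have "negligible E"
        using \<open>\<gamma> \<in> ?S\<close> by (simp add: negligible_iff_null_sets null_setsI)
      then show "negligible ?E" using \<open>?E \<subseteq> E\<close> by (rule negligible_subset)
      have "f differentiable (at t within {0..1})" if "t \<in> {0..1}" for t
      proof -
        have "(f has_vector_derivative (curve_deriv \<gamma> t $ 1)) (at t within {0..1})"
          unfolding f_def by (rule bounded_linear.has_vector_derivative[OF bounded_linear_vec_nth curve_has_deriv[OF that]])
        then show ?thesis by (rule differentiableI_vector)
      qed
      then have "f differentiable_on {0..1}" by (simp add: differentiable_on_def)
      then show "f differentiable_on ?E" by (rule differentiable_on_subset) auto
    qed simp
    ultimately show False using F(3) negligible_subset by blast
  qed
  ultimately show ?thesis by blast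
qed

end
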